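(* Let $\rho$ be a classical solution of $$\begin{cases}\rho_t-\operatorname{div}\big(\rho\nabla(d(x)\log\rho+\phi(x))\big)=0, & x\in\Omega,\ t>0,\\ \rho(x,0)=\rho_0(x), & x\in\Omega,\\ \rho\nabla(d(x)\log\rho+\phi(x))\cdot\nu=0, & x\in\partial\Omega,\ t>0.\end{cases}$$ Then there exist positive constants $c_1,c_2>0$, depending only on $d$, $\phi$ and $\rho_0$, such that $$c_1\le\rho\le c_2 .$$
   Context: $\Omega\subset\mathbb R^n$ is a bounded convex domain with smooth boundary and outer unit normal $\nu$ on $\partial\Omega$. The unknown is a function $\rho:\Omega\times[0,\infty)\to\mathbb R$. The function $d\in C^2(\overline\Omega)$ is given and satisfies $0<d_{\min}\le d(x)\le d_{\max}$ for $x\in\Omega$, with positive constants $d_{\min},d_{\max}$. The function $\phi\in C^2(\overline\Omega)$ is given and strictly convex in the sense that $\nabla^2\phi\ge\lambda I$ for some $\lambda>0$ (as symmetric matrices, $\nabla^2$ the Hessian, $I$ the identity). The initial datum $\rho_0\in C^2(\overline\Omega)$ is a positive probability density: $\int_\Omega\rho_0\,dx=1$. *)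

theory Defs
  imports "HOL-Analysis.Analysis"
begin

(* All derivatives are taken within a set S.  For open S they are the ordinary ones.  If S is the
   closure of a nonempty open convex set, they are unique, and "C_on k S f" agrees with the
   textbook class C^k(S): the derivatives of order at most k in the interior of S extend
   continuously to S. *)

primrec C_on :: "nat \<Rightarrow> 'a::real_normed_vector set \<Rightarrow> ('a \<Rightarrow> 'b::real_normed_vector) \<Rightarrow> bool" where
  "C_on 0 S f \<longleftrightarrow> continuous_on S f"
| "C_on (Suc k) S f \<longleftrightarrow>
     f differentiable_on S \<and> (\<forall>v. C_on k S (\<lambda>x. frechet_derivative f (at x within S) v))"

definition grad :: "(real^'n) set \<Rightarrow> (real^'n \<Rightarrow> real) \<Rightarrow> real^'n \<Rightarrow> real^'n" where
  "grad S f x = (\<chi> i. frechet_derivative f (at x within S) (axis i 1))"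

definition hess :: "(real^'n) set \<Rightarrow> (real^'n \<Rightarrow> real) \<Rightarrow> real^'n \<Rightarrow> real^'n^'n" where
  "hess S f x = jacobian (grad S f) (at x within S)"

definition divergence :: "(real^'n \<Rightarrow> real^'n) \<Rightarrow> real^'n \<Rightarrow> real" where
  "divergence F x = trace (jacobian F (at x))"

definition local_defining_function ::
    "(real^'n) set \<Rightarrow> real^'n \<Rightarrow> (real^'n) set \<Rightarrow> (real^'n \<Rightarrow> real) \<Rightarrow> bool" where
  "local_defining_function \<Omega> p U g \<longleftrightarrow>
     open U \<and> p \<in> U \<and> (\<forall>k. C_on k U g) \<and> (\<forall>x\<in>U. grad U g x \<noteq> 0) \<and>
     \<Omega> \<inter> U = {x \<in> U. g x < 0}"

definition smooth_boundary :: "(real^'n) set \<Rightarrow> bool" where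
  "smooth_boundary \<Omega> \<longleftrightarrow> (\<forall>p\<in>frontier \<Omega>. \<exists>U g. local_defining_function \<Omega> p U g)"

(* The vector does not depend on the choice of g; it points outward since g < 0 inside. *)
definition outer_unit_normal :: "(real^'n) set \<Rightarrow> real^'n \<Rightarrow> real^'n \<Rightarrow> bool" where
  "outer_unit_normal \<Omega> p v \<longleftrightarrow>
     (\<exists>U g. local_defining_function \<Omega> p U g \<and> v = grad U g p /\<^sub>R norm (grad U g p))"

definition flux ::
    "(real^'n) set \<Rightarrow> (real^'n \<Rightarrow> real) \<Rightarrow> (real^'n \<Rightarrow> real) \<Rightarrow> (real^'n \<Rightarrow> real \<Rightarrow> real) \<Rightarrow>
     real \<Rightarrow> real^'n \<Rightarrow> real^'n" where
  "flux \<Omega> d \<phi> \<rho> t x = \<rho> x t *\<^sub>R grad (closure \<Omega>) (\<lambda>y. d y * ln (\<rho> y t) + \<phi> y) x"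

(* C^{2,1} in the interior for t > 0, C^1 in x up to the boundary for t > 0 (so that the no-flux
   condition makes sense pointwise), and continuous down to t = 0. *)
definition classical_regularity :: "(real^'n) set \<Rightarrow> (real^'n \<Rightarrow> real \<Rightarrow> real) \<Rightarrow> bool" where
  "classical_regularity \<Omega> \<rho> \<longleftrightarrow>
     continuous_on (closure \<Omega> \<times> {0..}) (\<lambda>(x, t). \<rho> x t) \<and>
     (\<forall>t>0. C_on 1 (closure \<Omega>) (\<lambda>x. \<rho> x t)) \<and>
     continuous_on (closure \<Omega> \<times> {0<..}) (\<lambda>(x, t). grad (closure \<Omega>) (\<lambda>y. \<rho> y t) x) \<and>
     (\<forall>t>0. C_on 2 \<Omega> (\<lambda>x. \<rho> x t)) \<and>
     continuous_on (\<Omega> \<times> {0<..}) (\<lambda>(x, t). hess \<Omega> (\<lambda>y. \<rho> y t) x) \<and>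
     (\<forall>x\<in>\<Omega>. \<forall>t>0. (\<lambda>s. \<rho> x s) differentiable (at t)) \<and>
     continuous_on (\<Omega> \<times> {0<..}) (\<lambda>(x, t). deriv (\<lambda>s. \<rho> x s) t)"

(* Positivity of \<rho> is part of the notion of solution, since the equation and the boundary
   condition contain the logarithm of \<rho>. *)
definition classical_solution ::
    "(real^'n) set \<Rightarrow> (real^'n \<Rightarrow> real^'n) \<Rightarrow> (real^'n \<Rightarrow> real) \<Rightarrow> (real^'n \<Rightarrow> real) \<Rightarrow>
     (real^'n \<Rightarrow> real) \<Rightarrow> (real^'n \<Rightarrow> real \<Rightarrow> real) \<Rightarrow> bool" where
  "classical_solution \<Omega> \<nu> d \<phi> \<rho>0 \<rho> \<longleftrightarrow>
     classical_regularity \<Omega> \<rho> \<and>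
     (\<forall>x\<in>closure \<Omega>. \<forall>t>0. \<rho> x t > 0) \<and>
     (\<forall>x\<in>\<Omega>. \<forall>t>0. deriv (\<lambda>s. \<rho> x s) t - divergence (flux \<Omega> d \<phi> \<rho> t) x = 0) \<and>
     (\<forall>x\<in>\<Omega>. \<rho> x 0 = \<rho>0 x) \<and>
     (\<forall>x\<in>frontier \<Omega>. \<forall>t>0. flux \<Omega> d \<phi> \<rho> t x \<bullet> \<nu> x = 0)"

end

(* The potential u = d ln rho + phi satisfies u_t = d Lap u + d (grad rho / rho) . grad u, a linear
   equation without zeroth-order term, with homogeneous Neumann data.  Hence u stays between the
   extrema of its initial values, and rho = exp ((u - phi) / d) is bounded above and away from 0.
   Hopf's lemma is avoided by subtracting e (|x - q|^2 / 2 + K (t - tau)) from u, with q in the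
   domain: by convexity (x - q) . nu > 0 on the boundary, which rules out a boundary maximum.
   The drift may blow up as t -> 0, so the maximum principle is applied from a time tau > 0, and
   then tau -> 0 by uniform continuity. *)

theory Submission
  imports Defs
begin

section \<open>Gradients as representatives of the derivative\<close>

text \<open>Linearity and the expansion of \<open>v\<close> in the standard basis. Derivatives of
  scalar functions can then be handled as inner products with \<open>grad\<close>, at boundary
  points too.\<close>

lemma grad_inner:
  fixes f :: "real^'n \<Rightarrow> real"
  assumes "f differentiable (at x within S)"
  shows "grad S f x \<bullet> v = frechet_derivative f (at x within S) v"
proof -
  let ?D = "frechet_derivative f (at x within S)"
  have lin: "linear ?D"
    using assms by (rule linear_frechet_derivative)
  have "?D v = ?D (\<Sum>i\<in>UNIV. v $ i *\<^sub>R axis i 1)"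
    by (simp add: basis_expansion flip: scalar_mult_eq_scaleR)
  also have "\<dots> = (\<Sum>i\<in>UNIV. v $ i * ?D (axis i 1))"
    by (simp add: linear_sum[OF lin] linear_scale[OF lin])
  also have "\<dots> = grad S f x \<bullet> v"
    by (simp add: grad_def inner_vec_def mult.commute)
  finally show ?thesis ..
qed

lemma has_derivative_grad:
  fixes f :: "real^'n \<Rightarrow> real"
  assumes "f differentiable (at x within S)"
  shows "(f has_derivative (\<lambda>h. grad S f x \<bullet> h)) (at x within S)"
  using assms by (simp add: grad_inner frechet_derivative_works)

section \<open>Defining functions, outer normals and convexity\<close>

text \<open>Since \<open>\<Omega>\<close> is open, \<open>p\<close> lies outside it, so
  \<open>g p\<close> is not negative. If it were positive, \<open>g\<close> would be positive on a
  whole neighbourhood of \<open>p\<close>, which would then miss \<open>\<Omega>\<close> although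
  \<open>p\<close> is in its closure.\<close>

lemma local_defining_function_zero:
  fixes g :: "real^'n \<Rightarrow> real"
  assumes g: "local_defining_function \<Omega> p U g" and "open \<Omega>" and p: "p \<in> frontier \<Omega>"
  shows "g p = 0"
proof (rule ccontr)
  assume "g p \<noteq> 0"
  have U: "open U" "p \<in> U" "\<Omega> \<inter> U = {x \<in> U. g x < 0}"
    and "C_on 0 U g"
    using g unfolding local_defining_function_def by blast+
  then have cont: "continuous_on U g"
    by simp
  have "p \<notin> \<Omega>"
    using p \<open>open \<Omega>\<close> by (simp add: frontier_def interior_open)
  then have "g p > 0"
    using U \<open>g p \<noteq> 0\<close> by force
  have "open (U \<inter> g -` {0<..})"
    using cont U(1) by (simp add: continuous_open_preimage)
  moreover have "p \<in> U \<inter> g -` {0<..}"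
    using U \<open>g p > 0\<close> by simp
  moreover have "p \<in> closure \<Omega>"
    using p by (simp add: frontier_def)
  ultimately have "U \<inter> g -` {0<..} \<inter> \<Omega> \<noteq> {}"
    using open_Int_closure_eq_empty by blast
  then obtain y where "y \<in> \<Omega>" "y \<in> U" "g y > 0"
    by auto
  then show False
    using U by force
qed

lemma local_defining_function_has_derivative:
  fixes g :: "real^'n \<Rightarrow> real"
  assumes g: "local_defining_function \<Omega> p U g"
  shows "(g has_derivative (\<lambda>h. grad U g p \<bullet> h)) (at p)"
proof -
  have U: "open U" "p \<in> U" and "C_on (Suc 0) U g"
    using g unfolding local_defining_function_def by blast+
  then have "g differentiable (at p within U)"
    by (simp add: differentiable_on_def)
  then show ?thesis
    using has_derivative_grad at_within_open[OF U(2,1)] by metis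
qed

text \<open>Reduces directional questions about \<open>f\<close> to the sign of a one-variable
  derivative.\<close>

lemma has_derivative_along_line:
  fixes f :: "'a::real_normed_vector \<Rightarrow> real"
  assumes "(f has_derivative D) (at p)"
  shows "((\<lambda>s. f (p + s *\<^sub>R w)) has_real_derivative D w) (at 0)"
proof -
  have "((\<lambda>s. p + s *\<^sub>R w) has_derivative (\<lambda>s. s *\<^sub>R w)) (at 0)"
    by (auto intro!: derivative_eq_intros)
  then have "((\<lambda>s. f (p + s *\<^sub>R w)) has_derivative (\<lambda>s. D (s *\<^sub>R w))) (at 0)"
    using has_derivative_compose[of "\<lambda>s. p + s *\<^sub>R w" _ 0 UNIV f D] assms by simp
  then show ?thesis
    using has_derivative_bounded_linear[OF assms]
    by (simp add: has_field_derivative_def linear_simps mult.commute[of _ "D w"] mult_commute_abs)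
qed

lemma eventually_along_line:
  fixes p :: "'a::real_normed_vector"
  assumes "open U" "p \<in> U"
  shows "eventually (\<lambda>s. p + s *\<^sub>R w \<in> U) (at_right 0)"
proof -
  have "((\<lambda>s. p + s *\<^sub>R w) \<longlongrightarrow> p + 0 *\<^sub>R w) (at_right 0)"
    by (intro tendsto_intros)
  then show ?thesis
    using assms by (auto dest: topological_tendstoD)
qed

text \<open>\<open>g\<close> vanishes at \<open>p\<close> and has negative slope along
  \<open>- v\<close>, so it is negative just after \<open>p\<close>; near \<open>p\<close>,
  negativity of \<open>g\<close> means membership in \<open>\<Omega>\<close>.\<close>

lemma outer_unit_normal_inward:
  fixes \<Omega> :: "(real^'n) set"
  assumes "outer_unit_normal \<Omega> p v" and "open \<Omega>" and "p \<in> frontier \<Omega>"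
  shows "eventually (\<lambda>s. p + s *\<^sub>R (- v) \<in> \<Omega>) (at_right 0)"
proof -
  obtain U g where g: "local_defining_function \<Omega> p U g"
    and v: "v = grad U g p /\<^sub>R norm (grad U g p)"
    using assms(1) unfolding outer_unit_normal_def by blast
  have U: "open U" "p \<in> U" "grad U g p \<noteq> 0" "\<Omega> \<inter> U = {x \<in> U. g x < 0}"
    using g unfolding local_defining_function_def by blast+
  have g0: "g p = 0"
    by (rule local_defining_function_zero[OF g assms(2,3)])
  have "grad U g p \<bullet> (- v) < 0"
    using U(3) by (simp add: v)
  from DERIV_neg_dec_right[OF has_derivative_along_line
      [OF local_defining_function_has_derivative[OF g]] this]
  obtain e where "e > 0" "\<And>h. 0 < h \<Longrightarrow> h < e \<Longrightarrow> g (p + h *\<^sub>R (- v)) < 0"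
    using g0 by auto
  then have "eventually (\<lambda>s. g (p + s *\<^sub>R (- v)) < 0) (at_right 0)"
    by (auto simp: eventually_at_right_field)
  then show ?thesis
    using eventually_along_line[OF U(1,2), of "- v"]
    by eventually_elim (use U(4) in blast)
qed

text \<open>The gradient of \<open>g\<close> at \<open>p\<close> is normal to a hyperplane
  supporting the convex set \<open>\<Omega>\<close> at \<open>p\<close>; openness makes the
  inequality strict at \<open>q\<close>. This stands in for Hopf's lemma in the boundary case of the
  maximum principle.\<close>

lemma outer_unit_normal_inner_pos:
  fixes \<Omega> :: "(real^'n) set"
  assumes "outer_unit_normal \<Omega> p v" and \<Omega>: "open \<Omega>" "convex \<Omega>" and p: "p \<in> frontier \<Omega>"
    and q: "q \<in> \<Omega>"
  shows "(p - q) \<bullet> v > 0"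
proof -
  obtain U g where g: "local_defining_function \<Omega> p U g"
    and v: "v = grad U g p /\<^sub>R norm (grad U g p)"
    using assms(1) unfolding outer_unit_normal_def by blast
  have U: "open U" "p \<in> U" "grad U g p \<noteq> 0" "\<Omega> \<inter> U = {x \<in> U. g x < 0}"
    using g unfolding local_defining_function_def by blast+
  have g0: "g p = 0"
    by (rule local_defining_function_zero[OF g \<Omega>(1) p])
  let ?n = "grad U g p"
  \<comment> \<open>Supporting hyperplane: otherwise \<open>g\<close> would be positive just after
    \<open>p\<close> on the segment towards \<open>y\<close>, but by convexity that part of the
    segment lies in \<open>\<Omega>\<close>, where \<open>g\<close> is negative.\<close>
  have le: "?n \<bullet> (y - p) \<le> 0" if "y \<in> \<Omega>" for y
  proof (rule ccontr)
    assume "\<not> ?n \<bullet> (y - p) \<le> 0"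
    then have "?n \<bullet> (y - p) > 0"
      by simp
    from DERIV_pos_inc_right[OF has_derivative_along_line
        [OF local_defining_function_has_derivative[OF g]] this]
    obtain e where "e > 0" "\<And>h. 0 < h \<Longrightarrow> h < e \<Longrightarrow> g (p + h *\<^sub>R (y - p)) > 0"
      using g0 by auto
    then have "eventually (\<lambda>s. g (p + s *\<^sub>R (y - p)) > 0) (at_right 0)"
      by (auto simp: eventually_at_right_field)
    moreover have "eventually (\<lambda>s. 0 < s \<and> s < 1) (at_right (0::real))"
      by (auto simp: eventually_at_right_field intro: exI[of _ 1])
    moreover note eventually_along_line[OF U(1,2), of "y - p"]
    ultimately have "eventually (\<lambda>s. False) (at_right (0::real))"
    proof eventually_elim
      case (elim s)
      have "p \<in> closure \<Omega>"
        using p by (simp add: frontier_def)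
      \<comment> \<open>Points strictly between the closure point \<open>p\<close> and the interior
        point \<open>y\<close> are interior; \<open>1 - (1 - s)\<close> is merely
        \<open>s\<close>.\<close>
      then have "p - (1 - (1 - s)) *\<^sub>R (p - y) \<in> interior \<Omega>"
        using elim \<open>y \<in> \<Omega>\<close> \<Omega> by (intro mem_interior_closure_convex_shrink) (auto simp: interior_open)
      then have "p + s *\<^sub>R (y - p) \<in> \<Omega>"
        using \<Omega> by (simp add: interior_open algebra_simps)
      then show ?case
        using U(4) elim by force
    qed
    then show False
      by simp
  qed
  \<comment> \<open>A short step from \<open>q\<close> along \<open>?n\<close> stays in the open set
    \<open>\<Omega>\<close>; the supporting inequality at the new point gains the strictly positive
    term \<open>s * (?n \<bullet> ?n)\<close>.\<close>
  have "eventually (\<lambda>s. 0 < s \<and> q + s *\<^sub>R ?n \<in> \<Omega>) (at_right 0)"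
    using eventually_at_right_less eventually_along_line[OF \<Omega>(1) q]
    by (rule eventually_conj)
  then obtain s where s: "0 < s" "q + s *\<^sub>R ?n \<in> \<Omega>"
    using eventually_happens'[OF trivial_limit_at_right_real] by blast
  have "?n \<bullet> (q - p) + s * (?n \<bullet> ?n) \<le> 0"
    using le[OF s(2)] by (simp add: algebra_simps)
  moreover have "s * (?n \<bullet> ?n) > 0"
    using s U(3) by simp
  ultimately have "(p - q) \<bullet> ?n > 0"
    by (simp add: inner_commute algebra_simps)
  then show ?thesis
    using U(3) by (simp add: v)
qed

section \<open>The parabolic maximum principle with Neumann condition\<close>

text \<open>If \<open>l\<close> were positive, \<open>f'\<close> would be positive just to the right
  of 0 because it vanishes at 0, and the mean value theorem would give \<open>f h > f 0\<close> for
  small \<open>h > 0\<close>.\<close>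

lemma second_derivative_le_0_at_max:
  fixes f f' :: "real \<Rightarrow> real"
  assumes f': "eventually (\<lambda>s. (f has_real_derivative f' s) (at s)) (nhds 0)"
    and f'': "(f' has_real_derivative l) (at 0)"
    and max: "eventually (\<lambda>s. f s \<le> f 0) (nhds 0)"
    and zero: "f' 0 = 0"
  shows "l \<le> 0"
proof (rule ccontr)
  assume "\<not> l \<le> 0"
  then obtain e1 where e1: "e1 > 0" "\<And>h. 0 < h \<Longrightarrow> h < e1 \<Longrightarrow> f' h > 0"
    using DERIV_pos_inc_right[OF f''] zero by auto
  obtain e2 where e2: "e2 > 0" "\<And>s. \<bar>s\<bar> < e2 \<Longrightarrow> (f has_real_derivative f' s) (at s)"
    using f' by (auto simp: eventually_nhds_metric dist_real_def)
  obtain e3 where e3: "e3 > 0" "\<And>s. \<bar>s\<bar> < e3 \<Longrightarrow> f s \<le> f 0"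
    using max by (auto simp: eventually_nhds_metric dist_real_def)
  define h where "h = min e1 (min e2 e3) / 2"
  have h: "0 < h" "h < e1" "h < e2" "h < e3"
    using e1(1) e2(1) e3(1) by (auto simp: h_def)
  have "\<exists>z>0. z < h \<and> f h - f 0 = (h - 0) * f' z"
    by (intro MVT2 e2) (use h in auto)
  then obtain z where z: "0 < z" "z < h" "f h - f 0 = h * f' z"
    by auto
  have "h * f' z > 0"
    using e1(2)[of z] z h by simp
  then show False
    using z e3(2)[of h] h by simp
qed

text \<open>Restrict \<open>f\<close> to the coordinate lines through \<open>p\<close>: the
  \<open>i\<close>-th diagonal entry of \<open>matrix D\<close> is the second derivative along the
  \<open>i\<close>-th line. The trace is the Laplacian of \<open>f\<close> at
  \<open>p\<close>.\<close>

lemma trace_matrix_le_0_at_max: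
  fixes f :: "real^'n \<Rightarrow> real" and g :: "real^'n \<Rightarrow> real^'n"
  assumes S: "open S" "p \<in> S"
    and f: "\<And>x. x \<in> S \<Longrightarrow> (f has_derivative (\<lambda>h. g x \<bullet> h)) (at x)"
    and g: "(g has_derivative D) (at p)"
    and max: "\<And>x. x \<in> S \<Longrightarrow> f x \<le> f p"
  shows "g p = 0" and "trace (matrix D) \<le> 0"
proof -
  have "(\<lambda>h. g p \<bullet> h) = (\<lambda>h. 0)"
    using differential_zero_maxmin[OF S(2,1) f[OF S(2)]] max by blast
  then show g0: "g p = 0"
    by (metis inner_eq_zero_iff)
  have "D (axis i 1) $ i \<le> 0" for i
  proof (rule second_derivative_le_0_at_max)
    let ?l = "\<lambda>s. p + s *\<^sub>R axis i 1"
    have "(?l \<longlongrightarrow> p + 0 *\<^sub>R axis i 1) (nhds 0)"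
      by (intro tendsto_intros filterlim_ident)
    then have ev: "eventually (\<lambda>s. ?l s \<in> S) (nhds 0)"
      using S by (auto dest: topological_tendstoD)
    show "eventually (\<lambda>s. ((\<lambda>s. f (?l s)) has_real_derivative g (?l s) $ i) (at s)) (nhds 0)"
      using ev
    proof eventually_elim
      case (elim s)
      \<comment> \<open>The line is restarted at \<open>?l s\<close>, which puts the derivative at
        0; \<open>DERIV_shift\<close> then moves it to \<open>s\<close>.\<close>
      have "((\<lambda>h. f (?l s + h *\<^sub>R axis i 1)) has_real_derivative g (?l s) \<bullet> axis i 1) (at 0)"
        by (rule has_derivative_along_line[OF f[OF elim]])
      then show ?case
        using DERIV_shift[of "\<lambda>s. f (?l s)" "g (?l s) $ i" 0 s]
        by (simp add: inner_axis algebra_simps)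
    qed
    show "eventually (\<lambda>s. f (?l s) \<le> f (?l 0)) (nhds 0)"
      using ev by eventually_elim (simp add: max)
    show "g (?l 0) $ i = 0"
      using g0 by simp
    have "((\<lambda>x. g x $ i) has_derivative (\<lambda>h. D h $ i)) (at p)"
      by (rule bounded_linear.has_derivative[OF bounded_linear_vec_nth g])
    then show "((\<lambda>s. g (?l s) $ i) has_real_derivative D (axis i 1) $ i) (at 0)"
      by (rule has_derivative_along_line)
  qed
  then show "trace (matrix D) \<le> 0"
    unfolding trace_def matrix_def by (simp add: sum_nonpos)
qed

text \<open>\<open>G\<close> is the spatial gradient of \<open>u\<close> and \<open>D\<close> the
  derivative of \<open>G\<close>, so \<open>trace (matrix (D x t))\<close> is the Laplacian. After
  the initial time, a maximum of the perturbed function over the closed cylinder is excluded at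
  interior points by the equation and at boundary points by the normal derivative.\<close>

lemma neumann_maximum_principle:
  fixes u :: "real^'n \<Rightarrow> real \<Rightarrow> real" and G b :: "real^'n \<Rightarrow> real \<Rightarrow> real^'n"
    and D :: "real^'n \<Rightarrow> real \<Rightarrow> real^'n \<Rightarrow> real^'n" and a :: "real^'n \<Rightarrow> real \<Rightarrow> real"
  assumes \<Omega>: "open \<Omega>" "\<Omega> \<noteq> {}" "bounded \<Omega>" "convex \<Omega>"
    and normal: "\<And>x. x \<in> frontier \<Omega> \<Longrightarrow> outer_unit_normal \<Omega> x (\<nu> x)"
    and cont: "continuous_on (closure \<Omega> \<times> {\<tau>..T}) (\<lambda>(x, t). u x t)"
    and G: "\<And>x t. x \<in> closure \<Omega> \<Longrightarrow> \<tau> < t \<Longrightarrow> t \<le> T \<Longrightarrow>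
      ((\<lambda>y. u y t) has_derivative (\<lambda>h. G x t \<bullet> h)) (at x within closure \<Omega>)"
    and D: "\<And>x t. x \<in> \<Omega> \<Longrightarrow> \<tau> < t \<Longrightarrow> t \<le> T \<Longrightarrow> ((\<lambda>y. G y t) has_derivative D x t) (at x)"
    and u_t: "\<And>x t. x \<in> \<Omega> \<Longrightarrow> \<tau> < t \<Longrightarrow> t \<le> T \<Longrightarrow>
      ((\<lambda>s. u x s) has_real_derivative a x t * trace (matrix (D x t)) + b x t \<bullet> G x t) (at t)"
    and a: "\<And>x t. x \<in> \<Omega> \<Longrightarrow> \<tau> < t \<Longrightarrow> t \<le> T \<Longrightarrow> 0 \<le> a x t \<and> a x t \<le> A"
    and b: "\<And>x t. x \<in> \<Omega> \<Longrightarrow> \<tau> < t \<Longrightarrow> t \<le> T \<Longrightarrow> norm (b x t) \<le> B"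
    and neumann: "\<And>x t. x \<in> frontier \<Omega> \<Longrightarrow> \<tau> < t \<Longrightarrow> t \<le> T \<Longrightarrow> G x t \<bullet> \<nu> x = 0"
    and init: "\<And>x. x \<in> closure \<Omega> \<Longrightarrow> u x \<tau> \<le> M"
    and x: "x \<in> closure \<Omega>" and t: "\<tau> \<le> t" "t \<le> T"
  shows "u x t \<le> M"
proof -
  obtain q where q: "q \<in> \<Omega>"
    using \<Omega>(2) by blast
  have "bounded ((\<lambda>x. x - q) ` closure \<Omega>)"
    using \<Omega>(3) by (auto intro!: bounded_translation_minus)
  then obtain R where R: "R > 0" "\<And>x. x \<in> closure \<Omega> \<Longrightarrow> norm (x - q) \<le> R"
    unfolding bounded_pos by auto
  \<comment> \<open>The perturbation |x - q|^2 / 2 has Laplacian \<open>CARD('n)\<close> and a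
    gradient of norm at most \<open>R\<close>. The time slope \<open>K\<close> beats the
    contributions of both, and the summand 1 makes this strict.\<close>
  define K where "K = \<bar>A\<bar> * CARD('n) + \<bar>B\<bar> * R + 1"
  have "K > 0"
    using R(1) by (simp add: K_def add_nonneg_pos)
  have sub: "\<Omega> \<subseteq> closure \<Omega>"
    by (rule closure_subset)
  have perturbed: "u x t - e * ((x - q) \<bullet> (x - q) / 2 + K * (t - \<tau>)) \<le> M" if "e > 0" for e
  proof -
    define v where "v = (\<lambda>x t. u x t - e * ((x - q) \<bullet> (x - q) / 2 + K * (t - \<tau>)))"
    \<comment> \<open>\<open>H\<close> is the spatial gradient of the perturbed function
      \<open>v\<close>.\<close>
    define H where "H = (\<lambda>x t. G x t - e *\<^sub>R (x - q))"
    have "compact (closure \<Omega> \<times> {\<tau>..T})"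
      using \<Omega>(3) by (intro compact_Times) (auto simp: compact_closure)
    moreover have "continuous_on (closure \<Omega> \<times> {\<tau>..T}) (\<lambda>(x, t). v x t)"
      using cont unfolding v_def case_prod_unfold by (intro continuous_intros) auto
    moreover have "(x, t) \<in> closure \<Omega> \<times> {\<tau>..T}"
      using x t by simp
    ultimately obtain z where z: "z \<in> closure \<Omega> \<times> {\<tau>..T}"
      and z_max: "\<forall>w\<in>closure \<Omega> \<times> {\<tau>..T}. (\<lambda>(x, t). v x t) w \<le> (\<lambda>(x, t). v x t) z"
      using continuous_attains_sup[of "closure \<Omega> \<times> {\<tau>..T}" "\<lambda>(x, t). v x t"] by blast
    obtain p s where "z = (p, s)"
      by (cases z)
    then have p: "p \<in> closure \<Omega>" and s: "\<tau> \<le> s" "s \<le> T"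
      and max: "\<And>y r. y \<in> closure \<Omega> \<Longrightarrow> \<tau> \<le> r \<Longrightarrow> r \<le> T \<Longrightarrow> v y r \<le> v p s"
      using z z_max by auto
    have v_H: "((\<lambda>y. v y s) has_derivative (\<lambda>h. H y s \<bullet> h)) (at y within closure \<Omega>)"
      if "y \<in> closure \<Omega>" "\<tau> < s" for y
      unfolding v_def H_def
      by (auto intro!: derivative_eq_intros G[OF that s(2)] ext simp: algebra_simps inner_commute diff_divide_distrib)
    have "s = \<tau>"
    proof (rule ccontr)
      assume "s \<noteq> \<tau>"
      with s have "\<tau> < s"
        by simp
      show False
      proof (cases "p \<in> \<Omega>")
        case True
        have H_D: "((\<lambda>y. H y s) has_derivative (\<lambda>h. D p s h - e *\<^sub>R h)) (at p)"
          unfolding H_def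
          by (auto intro!: derivative_eq_intros D[OF True \<open>\<tau> < s\<close> s(2)])
        have v_H': "((\<lambda>y. v y s) has_derivative (\<lambda>h. H y s \<bullet> h)) (at y)" if "y \<in> \<Omega>" for y
          using v_H[OF subsetD[OF sub that] \<open>\<tau> < s\<close>]
          unfolding at_within_open_subset[OF that \<Omega>(1) sub] .
        \<comment> \<open>First and second order conditions for \<open>v\<close> at an interior
          maximum; translated to \<open>u\<close>, they leave errors proportional to
          \<open>e\<close> in the gradient and the Laplacian.\<close>
        have "H p s = 0" and "trace (matrix (\<lambda>h. D p s h - e *\<^sub>R h)) \<le> 0"
          using trace_matrix_le_0_at_max[OF \<Omega>(1) True v_H' H_D] max sub s by auto
        then have Gp: "G p s = e *\<^sub>R (p - q)" and tr: "trace (matrix (D p s)) \<le> e * CARD('n)"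
          by (simp_all add: H_def trace_def matrix_def sum_subtractf mult.commute)
        let ?l = "a p s * trace (matrix (D p s)) + b p s \<bullet> G p s"
        have v_t: "((\<lambda>r. v p r) has_real_derivative ?l - e * K) (at s)"
          unfolding v_def
          by (auto intro!: derivative_eq_intros u_t[OF True \<open>\<tau> < s\<close> s(2)])
        have "a p s * trace (matrix (D p s)) \<le> a p s * (e * CARD('n))"
          using a[OF True \<open>\<tau> < s\<close> s(2)] tr by (simp add: mult_left_mono)
        also have "\<dots> \<le> \<bar>A\<bar> * (e * CARD('n))"
          using a[OF True \<open>\<tau> < s\<close> s(2)] \<open>e > 0\<close> by (intro mult_right_mono) auto
        finally have 1: "a p s * trace (matrix (D p s)) \<le> e * (\<bar>A\<bar> * CARD('n))"
          by (simp add: ac_simps)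
        have "b p s \<bullet> (p - q) \<le> norm (b p s) * norm (p - q)"
          by (rule norm_cauchy_schwarz)
        also have "\<dots> \<le> \<bar>B\<bar> * R"
          using b[OF True \<open>\<tau> < s\<close> s(2)] R(2)[OF p] by (intro mult_mono) auto
        finally have 2: "b p s \<bullet> G p s \<le> e * (\<bar>B\<bar> * R)"
          using \<open>e > 0\<close> by (simp add: Gp)
        \<comment> \<open>So \<open>v\<close> decreases in time at \<open>(p, s)\<close> and was
          larger slightly earlier. Looking only backwards covers the case \<open>s = T\<close> as
          well.\<close>
        have "?l - e * K < 0"
          using 1 2 \<open>e > 0\<close> by (simp add: K_def distrib_left)
        from DERIV_neg_dec_left[OF v_t this]
        obtain \<delta> where \<delta>: "\<delta> > 0" "\<And>h. 0 < h \<Longrightarrow> h < \<delta> \<Longrightarrow> v p s < v p (s - h)"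
          by auto
        define h where "h = min \<delta> (s - \<tau>) / 2"
        have "0 < h" "h < \<delta>" "h < s - \<tau>"
          using \<delta>(1) \<open>\<tau> < s\<close> by (auto simp: h_def)
        then show False
          using \<delta>(2)[of h] max[OF p, of "s - h"] s by simp
      next
        case False
        then have fr: "p \<in> frontier \<Omega>"
          using p \<Omega>(1) by (simp add: frontier_def interior_open)
        \<comment> \<open>The Neumann condition removes \<open>G\<close>; by convexity the remaining
          term makes \<open>v\<close> increase along the inward direction
          \<open>- \<nu> p\<close>.\<close>
        have "H p s \<bullet> \<nu> p = - e * ((p - q) \<bullet> \<nu> p)"
          using neumann[OF fr \<open>\<tau> < s\<close> s(2)] by (simp add: H_def algebra_simps)
        then have pos: "H p s \<bullet> (- \<nu> p) > 0"
          using outer_unit_normal_inner_pos[OF normal[OF fr] \<Omega>(1,4) fr q] \<open>e > 0\<close> by simp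
        obtain \<delta> where \<delta>: "\<delta> > 0" "\<And>r. 0 < r \<Longrightarrow> r < \<delta> \<Longrightarrow> p + r *\<^sub>R (- \<nu> p) \<in> \<Omega>"
          using outer_unit_normal_inward[OF normal[OF fr] \<Omega>(1) fr]
          by (auto simp: eventually_at_right_field)
        let ?l = "\<lambda>r. p + r *\<^sub>R (- \<nu> p)"
        \<comment> \<open>At a boundary point the derivative of \<open>v\<close> is known only
          within the closure. Hence \<open>v\<close> is composed with a short inward segment, which
          stays there, and a one-sided derivative at 0 is used.\<close>
        have "(?l has_derivative (\<lambda>r. r *\<^sub>R (- \<nu> p))) (at 0 within {0..<\<delta>})"
          by (auto intro!: derivative_eq_intros)
        moreover have "?l r \<in> closure \<Omega>" if "r \<in> {0..<\<delta>}" for r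
          using \<delta>(2)[of r] sub p that by (cases "r = 0") auto
        then have "?l ` {0..<\<delta>} \<subseteq> closure \<Omega>"
          by blast
        then have "((\<lambda>y. v y s) has_derivative (\<lambda>h. H p s \<bullet> h)) (at (?l 0) within ?l ` {0..<\<delta>})"
          using has_derivative_subset[OF v_H[OF p \<open>\<tau> < s\<close>]] by simp
        ultimately have "((\<lambda>r. v (?l r) s) has_derivative (\<lambda>r. H p s \<bullet> (r *\<^sub>R (- \<nu> p))))
            (at 0 within {0..<\<delta>})"
          by (rule has_derivative_in_compose)
        then have "((\<lambda>r. v (?l r) s) has_real_derivative H p s \<bullet> (- \<nu> p)) (at 0 within {0..<\<delta>})"
          unfolding has_field_derivative_def
          by (rule has_derivative_eq_rhs) (simp add: fun_eq_iff)
        from has_real_derivative_pos_inc_right[OF this pos]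
        obtain \<gamma> where \<gamma>: "\<gamma> > 0"
          "\<And>h. 0 < h \<Longrightarrow> h \<in> {0..<\<delta>} \<Longrightarrow> h < \<gamma> \<Longrightarrow> v p s < v (?l h) s"
          by auto
        define h where "h = min \<delta> \<gamma> / 2"
        have "0 < h" "h < \<delta>" "h < \<gamma>"
          using \<delta>(1) \<gamma>(1) by (auto simp: h_def)
        then show False
          using \<gamma>(2)[of h] max[of "?l h" s] \<delta>(2)[of h] sub s by force
      qed
    qed
    have "v x t \<le> v p s"
      using max x t by simp
    \<comment> \<open>At time \<open>\<tau>\<close> the subtracted term is \<open>e\<close> times |p
      - q|^2 / 2, which is nonnegative.\<close>
    also have "\<dots> \<le> u p \<tau>"
      using \<open>e > 0\<close> by (simp add: v_def \<open>s = \<tau>\<close>)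
    also have "\<dots> \<le> M"
      using init p by simp
    finally show ?thesis
      by (simp add: v_def)
  qed
  \<comment> \<open>\<open>C\<close> is the perturbation at the fixed point \<open>(x, t)\<close>
    without the factor \<open>e\<close>. The choice \<open>e = \<delta> / (C + 1)\<close> makes the
    error at most \<open>\<delta>\<close>, and the 1 keeps the denominator positive.\<close>
  define C where "C = (x - q) \<bullet> (x - q) / 2 + K * (t - \<tau>)"
  have "C \<ge> 0"
    using \<open>K > 0\<close> t by (simp add: C_def)
  show ?thesis
  proof (rule field_le_epsilon)
    fix \<delta> :: real
    assume "\<delta> > 0"
    then have "u x t - \<delta> / (C + 1) * C \<le> M"
      using perturbed[of "\<delta> / (C + 1)"] \<open>C \<ge> 0\<close> by (simp add: C_def)
    moreover have "\<delta> / (C + 1) * C \<le> \<delta>"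
      using \<open>C \<ge> 0\<close> \<open>\<delta> > 0\<close> by (simp add: field_simps)
    ultimately show "u x t \<le> M + \<delta>"
      by simp
  qed
qed

section \<open>Derivatives of the potential and of the flux\<close>

text \<open>With \<open>r\<close> the density and \<open>G\<close> the gradient of the potential,
  the two terms become the diffusion and the drift of the linear equation.\<close>

lemma divergence_scaleR:
  fixes G :: "real^'n \<Rightarrow> real^'n"
  assumes "(r has_derivative (\<lambda>h. g \<bullet> h)) (at x)" and "(G has_derivative D) (at x)"
  shows "divergence (\<lambda>y. r y *\<^sub>R G y) x = r x * trace (matrix D) + g \<bullet> G x"
proof -
  have "((\<lambda>y. r y *\<^sub>R G y) has_derivative (\<lambda>h. r x *\<^sub>R D h + (g \<bullet> h) *\<^sub>R G x)) (at x)"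
    by (rule has_derivative_scaleR[OF assms])
  from frechet_derivative_at[OF this, symmetric] show ?thesis
    by (simp add: divergence_def jacobian_def trace_def matrix_def sum.distrib sum_distrib_left
        inner_axis inner_vec_def[of g "G x"])
qed

text \<open>\<open>d\<close> and \<open>\<phi>\<close> are twice differentiable on the closure, the
  density only in \<open>\<Omega>\<close>; this brings all three to ordinary derivatives at interior
  points.\<close>

lemma C_on_2_interior:
  fixes f :: "'a::real_normed_vector \<Rightarrow> 'b::real_normed_vector"
  assumes "C_on 2 S f" and \<Omega>: "open \<Omega>" "\<Omega> \<subseteq> S" and x: "x \<in> \<Omega>"
  shows "f differentiable (at x)"
    and "(\<lambda>y. frechet_derivative f (at y) v) differentiable (at x)"
proof -
  have at: "at y within S = at y" if "y \<in> \<Omega>" for y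
    by (rule at_within_open_subset[OF that \<Omega>])
  have S: "f differentiable_on S"
    "(\<lambda>y. frechet_derivative f (at y within S) v) differentiable_on S"
    using assms(1) by (simp_all add: numeral_2_eq_2)
  show "f differentiable (at x)"
    using S(1) x \<Omega>(2) at[OF x] by (auto simp: differentiable_on_def dest!: bspec)
  have "(\<lambda>y. frechet_derivative f (at y within S) v) differentiable (at x)"
    using S(2) x \<Omega>(2) at[OF x] by (auto simp: differentiable_on_def dest!: bspec)
  then obtain D where "((\<lambda>y. frechet_derivative f (at y within S) v) has_derivative D) (at x)"
    by (auto simp: differentiable_def)
  then have "((\<lambda>y. frechet_derivative f (at y) v) has_derivative D) (at x)"
    by (rule has_derivative_transform_within_open[OF _ \<Omega>(1) x]) (simp add: at)
  then show "(\<lambda>y. frechet_derivative f (at y) v) differentiable (at x)"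
    by (rule differentiableI)
qed

lemma has_derivative_mult_ln:
  fixes d r \<phi> :: "'a::real_normed_vector \<Rightarrow> real"
  assumes "d differentiable (at x within S)" "r differentiable (at x within S)"
    and "\<phi> differentiable (at x within S)" and "r x > 0"
  shows "((\<lambda>y. d y * ln (r y) + \<phi> y) has_derivative
    (\<lambda>h. d x * (frechet_derivative r (at x within S) h / r x)
       + frechet_derivative d (at x within S) h * ln (r x)
       + frechet_derivative \<phi> (at x within S) h)) (at x within S)"
proof -
  note D = assms(1-3)[unfolded frechet_derivative_works]
  have "((\<lambda>y. ln (r y)) has_derivative (\<lambda>h. frechet_derivative r (at x within S) h / r x))
      (at x within S)"
    using has_derivative_ln[OF assms(4) D(2)] by (simp add: divide_inverse)
  from has_derivative_add[OF has_derivative_mult[OF D(1) this] D(3)] show ?thesis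
    by simp
qed

text \<open>On \<open>\<Omega>\<close> each component of the gradient equals an explicit expression
  in \<open>d\<close>, \<open>r\<close>, \<open>ln r\<close> and first derivatives of C^2 functions,
  so it is differentiable. This provides the second derivative of the potential.\<close>

lemma grad_mult_ln_differentiable:
  fixes \<Omega> :: "(real^'n) set"
  assumes \<Omega>: "open \<Omega>" and x: "x \<in> \<Omega>"
    and d: "C_on 2 (closure \<Omega>) d" and \<phi>: "C_on 2 (closure \<Omega>) \<phi>" and r: "C_on 2 \<Omega> r"
    and pos: "\<And>y. y \<in> \<Omega> \<Longrightarrow> r y > 0"
  shows "(\<lambda>y. grad (closure \<Omega>) (\<lambda>z. d z * ln (r z) + \<phi> z) y) differentiable (at x)"
proof -
  let ?u = "\<lambda>z. d z * ln (r z) + \<phi> z"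
  let ?g = "\<lambda>i y. d y * (frechet_derivative r (at y) (axis i 1) / r y)
      + frechet_derivative d (at y) (axis i 1) * ln (r y) + frechet_derivative \<phi> (at y) (axis i 1)"
  note dI = C_on_2_interior[OF d \<Omega> closure_subset]
    and \<phi>I = C_on_2_interior[OF \<phi> \<Omega> closure_subset]
    and rI = C_on_2_interior[OF r \<Omega> subset_refl]
  have grad_eq: "?g i y = grad (closure \<Omega>) ?u y $ i" if "y \<in> \<Omega>" for y i
    using fun_cong[OF frechet_derivative_at[OF has_derivative_mult_ln
          [OF dI(1) rI(1) \<phi>I(1) pos]], OF that that that that, of "axis i 1"]
    by (simp add: grad_def at_within_open_subset[OF that \<Omega> closure_subset])
  \<comment> \<open>The case of \<open>d\<close> constantly 1 and \<open>\<phi>\<close> constantly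
    0.\<close>
  have "(\<lambda>y. ln (r y)) differentiable (at x)"
    using has_derivative_mult_ln[OF _ rI(1)[OF x] _ pos[OF x], of "\<lambda>_. 1" "\<lambda>_. 0"]
    by (auto intro: differentiableI)
  then have g: "?g i differentiable (at x)" for i
    using pos[OF x]
    by (intro differentiable_add differentiable_mult differentiable_divide dI \<phi>I rI x) auto
  have "(\<lambda>y. grad (closure \<Omega>) ?u y $ i) differentiable (at x)" for i
  proof -
    obtain D where "(?g i has_derivative D) (at x)"
      using g[of i] unfolding differentiable_def ..
    then have "((\<lambda>y. grad (closure \<Omega>) ?u y $ i) has_derivative D) (at x)"
      by (rule has_derivative_transform_within_open[OF _ \<Omega> x]) (rule grad_eq)
    then show ?thesis
      by (rule differentiableI)
  qed
  then show ?thesis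
    by (intro iffD2[OF differentiable_componentwise_within]) (auto simp: Basis_vec_def inner_axis)
qed

section \<open>Bounds for the potential of a solution\<close>

text \<open>A solution is prescribed at time 0 only in \<open>\<Omega>\<close>; continuity carries
  the equality to the closure.\<close>

lemma classical_solution_initial:
  assumes sol: "classical_solution \<Omega> \<nu> d \<phi> \<rho>0 \<rho>"
    and "continuous_on (closure \<Omega>) \<rho>0" and x: "x \<in> closure \<Omega>"
  shows "\<rho> x 0 = \<rho>0 x"
proof -
  have "continuous_on (closure \<Omega> \<times> {0..}) (\<lambda>(x, t). \<rho> x t)"
    using sol by (simp add: classical_solution_def classical_regularity_def)
  then have "continuous_on (closure \<Omega>) (\<lambda>x. case (x, 0) of (x, t) \<Rightarrow> \<rho> x t)"
    by (rule continuous_on_compose2) (auto intro!: continuous_intros)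
  then have "continuous_on (closure \<Omega>) (\<lambda>x. \<rho> x 0 - \<rho>0 x)"
    using assms(2) by (auto intro: continuous_on_diff)
  moreover have "\<rho> x 0 - \<rho>0 x = 0" if "x \<in> \<Omega>" for x
    using sol that by (simp add: classical_solution_def)
  ultimately have "\<rho> x 0 - \<rho>0 x = 0"
    using x by (rule continuous_constant_on_closure)
  then show ?thesis
    by simp
qed

text \<open>The linear equation and the Neumann condition survive multiplication by a constant, so
  \<open>c = 1\<close> gives the upper and \<open>c = - 1\<close> the lower bound for the
  potential.\<close>

lemma potential_maximum_principle:
  fixes \<Omega> :: "(real^'n) set" and c :: real
  assumes \<Omega>: "open \<Omega>" "\<Omega> \<noteq> {}" "bounded \<Omega>" "convex \<Omega>"
    and normal: "\<And>x. x \<in> frontier \<Omega> \<Longrightarrow> outer_unit_normal \<Omega> x (\<nu> x)"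
    and d: "C_on 2 (closure \<Omega>) d" and d_bounds: "\<And>x. x \<in> \<Omega> \<Longrightarrow> 0 \<le> d x \<and> d x \<le> A"
    and \<phi>: "C_on 2 (closure \<Omega>) \<phi>"
    and \<rho>0: "continuous_on (closure \<Omega>) \<rho>0" "\<And>x. x \<in> closure \<Omega> \<Longrightarrow> \<rho>0 x > 0"
    and sol: "classical_solution \<Omega> \<nu> d \<phi> \<rho>0 \<rho>"
    and init: "\<And>x. x \<in> closure \<Omega> \<Longrightarrow> c * (d x * ln (\<rho>0 x) + \<phi> x) \<le> M"
    and x: "x \<in> closure \<Omega>" and t: "0 \<le> t"
  shows "c * (d x * ln (\<rho> x t) + \<phi> x) \<le> M"
proof (cases "t = 0")
  case True
  then show ?thesis
    using init[OF x] classical_solution_initial[OF sol \<rho>0(1) x] by simp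
next
  case False
  with t have "t > 0"
    by simp
  let ?S = "closure \<Omega>"
  define u where "u = (\<lambda>x t. d x * ln (\<rho> x t) + \<phi> x)"
  define G where "G = (\<lambda>x t. grad ?S (\<lambda>y. u y t) x)"
  define D where "D = (\<lambda>x t. frechet_derivative (\<lambda>y. G y t) (at x))"
  define g where "g = (\<lambda>x t. grad ?S (\<lambda>y. \<rho> y t) x)"
  \<comment> \<open>The drift involves the solution itself; regarding it as a given coefficient
    makes the equation for \<open>u\<close> linear.\<close>
  define b where "b = (\<lambda>x t. (d x / \<rho> x t) *\<^sub>R g x t)"
  have \<rho>_cont: "continuous_on (?S \<times> {0..}) (\<lambda>(x, t). \<rho> x t)"
    and \<rho>_C1: "\<And>t. t > 0 \<Longrightarrow> C_on 1 ?S (\<lambda>x. \<rho> x t)"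
    and g_cont: "continuous_on (?S \<times> {0<..}) (\<lambda>(x, t). g x t)"
    and \<rho>_C2: "\<And>t. t > 0 \<Longrightarrow> C_on 2 \<Omega> (\<lambda>x. \<rho> x t)"
    and \<rho>_t: "\<And>x t. x \<in> \<Omega> \<Longrightarrow> t > 0 \<Longrightarrow> (\<lambda>s. \<rho> x s) differentiable (at t)"
    and \<rho>_pos': "\<And>x t. x \<in> ?S \<Longrightarrow> t > 0 \<Longrightarrow> \<rho> x t > 0"
    and pde: "\<And>x t. x \<in> \<Omega> \<Longrightarrow> t > 0 \<Longrightarrow>
      deriv (\<lambda>s. \<rho> x s) t = divergence (flux \<Omega> d \<phi> \<rho> t) x"
    and no_flux: "\<And>x t. x \<in> frontier \<Omega> \<Longrightarrow> t > 0 \<Longrightarrow> flux \<Omega> d \<phi> \<rho> t x \<bullet> \<nu> x = 0"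
    using sol by (simp_all add: classical_solution_def classical_regularity_def g_def)
  have \<rho>_init: "\<rho> y 0 = \<rho>0 y" if "y \<in> ?S" for y
    by (rule classical_solution_initial[OF sol \<rho>0(1) that])
  \<comment> \<open>At time 0 positivity is inherited from the initial datum, at later times it is
    part of the notion of solution.\<close>
  have \<rho>_pos: "\<rho> y s > 0" if "y \<in> ?S" "s \<ge> 0" for y s
    using \<rho>_pos'[of y s] \<rho>_init[of y] \<rho>0(2)[of y] that by (cases "s = 0") auto
  have sub: "\<Omega> \<subseteq> ?S"
    by (rule closure_subset)
  have at: "at y within ?S = at y" if "y \<in> \<Omega>" for y
    by (rule at_within_open_subset[OF that \<Omega>(1) sub])
  have d_diff: "d differentiable_on ?S" and \<phi>_diff: "\<phi> differentiable_on ?S"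
    using d \<phi> by (simp_all add: numeral_2_eq_2)
  then have d_cont: "continuous_on ?S d" and \<phi>_cont: "continuous_on ?S \<phi>"
    by (auto intro: differentiable_imp_continuous_on)
  have \<rho>_diff: "(\<lambda>y. \<rho> y s) differentiable (at y within ?S)" if "y \<in> ?S" "s > 0" for y s
    using \<rho>_C1[OF that(2)] that(1) by (simp add: differentiable_on_def)
  have fst_cont: "continuous_on (?S \<times> I) (\<lambda>z. f (fst z))" if "continuous_on ?S f"
    for I :: "real set" and f :: "real^'n \<Rightarrow> real"
    by (rule continuous_on_compose2[OF that]) (auto intro!: continuous_intros)
  have u_cont: "continuous_on (?S \<times> {0..}) (\<lambda>(x, t). u x t)"
    using \<rho>_cont fst_cont[OF d_cont] fst_cont[OF \<phi>_cont]
    unfolding u_def case_prod_unfold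
    by (intro continuous_intros) (auto dest!: \<rho>_pos)
  have u_cont': "continuous_on (?S \<times> {r..t}) (\<lambda>(x, t). c * u x t)" if "r \<ge> 0" for r
  proof -
    have "?S \<times> {r..t} \<subseteq> ?S \<times> {0..}"
      using that by auto
    from continuous_on_subset[OF u_cont this] show ?thesis
      by (auto simp: case_prod_unfold intro!: continuous_intros)
  qed
  have G: "((\<lambda>y. u y s) has_derivative (\<lambda>h. G y s \<bullet> h)) (at y within ?S)"
    if "y \<in> ?S" "s > 0" for y s
    unfolding G_def
  proof (rule has_derivative_grad)
    show "(\<lambda>y. u y s) differentiable at y within ?S"
      using has_derivative_mult_ln[OF _ \<rho>_diff[OF that] _ \<rho>_pos'[OF that], of d \<phi>]
        d_diff \<phi>_diff that(1)
      unfolding u_def by (meson differentiableI differentiable_on_def)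
  qed
  have D: "((\<lambda>y. G y s) has_derivative D y s) (at y)" if "y \<in> \<Omega>" "s > 0" for y s
    using grad_mult_ln_differentiable[OF \<Omega>(1) that(1) d \<phi> \<rho>_C2[OF that(2)]] \<rho>_pos' that sub
    unfolding D_def G_def u_def by (auto simp flip: frechet_derivative_works)
  have flux_eq: "flux \<Omega> d \<phi> \<rho> s = (\<lambda>y. \<rho> y s *\<^sub>R G y s)" for s
    by (simp add: fun_eq_iff flux_def G_def u_def)
  have u_t: "((\<lambda>s. u y s) has_real_derivative d y * trace (matrix (D y s)) + b y s \<bullet> G y s) (at s)"
    if "y \<in> \<Omega>" "s > 0" for y s
  proof -
    have "y \<in> ?S"
      using that sub by blast
    note pos = \<rho>_pos'[OF this that(2)]
    have "((\<lambda>y. \<rho> y s) has_derivative (\<lambda>h. g y s \<bullet> h)) (at y)"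
      using has_derivative_grad[OF \<rho>_diff[OF \<open>y \<in> ?S\<close> that(2)]] by (simp add: at that g_def)
    \<comment> \<open>The equation reads rho_t = rho Lap u + grad rho . grad u. As \<open>d\<close>
      and \<open>\<phi>\<close> do not depend on time, u_t is \<open>d / \<rho>\<close> times the
      right-hand side.\<close>
    from divergence_scaleR[OF this D[OF that]]
    have "deriv (\<lambda>s. \<rho> y s) s = \<rho> y s * trace (matrix (D y s)) + g y s \<bullet> G y s"
      by (simp add: pde[OF that] flux_eq)
    then have "((\<lambda>s. \<rho> y s) has_real_derivative
        \<rho> y s * trace (matrix (D y s)) + g y s \<bullet> G y s) (at s)"
      using \<rho>_t[OF that] by (metis DERIV_deriv_iff_real_differentiable)
    then have "((\<lambda>s. u y s) has_real_derivative
        d y * ((\<rho> y s * trace (matrix (D y s)) + g y s \<bullet> G y s) / \<rho> y s)) (at s)"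
      using pos unfolding u_def by (auto intro!: derivative_eq_intros)
    also have "d y * ((\<rho> y s * trace (matrix (D y s)) + g y s \<bullet> G y s) / \<rho> y s)
        = d y * trace (matrix (D y s)) + b y s \<bullet> G y s"
      using pos by (simp add: b_def field_simps)
    finally show ?thesis .
  qed
  \<comment> \<open>The flux is \<open>\<rho>\<close> times the gradient of \<open>u\<close>, and
    the positive factor can be divided out.\<close>
  have neumann: "G y s \<bullet> \<nu> y = 0" if "y \<in> frontier \<Omega>" "s > 0" for y s
    using no_flux[OF that] \<rho>_pos'[of y s] that by (simp add: flux_eq frontier_def)
  show ?thesis
  proof (rule field_le_epsilon)
    fix e :: real
    assume "e > 0"
    \<comment> \<open>Uniform continuity down to time 0 gives a time \<open>\<tau>\<close>, the same
      for all points, at which the initial bound still holds up to \<open>e\<close>.\<close>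
    have "uniformly_continuous_on (?S \<times> {0..t}) (\<lambda>(x, t). c * u x t)"
    proof (rule compact_uniformly_continuous)
      show "continuous_on (?S \<times> {0..t}) (\<lambda>(x, t). c * u x t)"
        by (rule u_cont') simp
      show "compact (?S \<times> {0..t})"
        using \<Omega>(3) by (intro compact_Times) (auto simp: compact_closure)
    qed
    then obtain \<delta> where \<delta>: "\<delta> > 0" "\<And>z w. z \<in> ?S \<times> {0..t} \<Longrightarrow> w \<in> ?S \<times> {0..t} \<Longrightarrow>
        dist w z < \<delta> \<Longrightarrow> dist ((\<lambda>(x, t). c * u x t) w) ((\<lambda>(x, t). c * u x t) z) < e"
      unfolding uniformly_continuous_on_def using \<open>e > 0\<close> by metis
    define \<tau> where "\<tau> = min \<delta> t / 2"
    have \<tau>: "0 < \<tau>" "\<tau> < \<delta>" "\<tau> < t"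
      using \<delta>(1) \<open>t > 0\<close> by (auto simp: \<tau>_def)
    have init_\<tau>: "c * u y \<tau> \<le> M + e" if "y \<in> ?S" for y
    proof -
      have "dist (c * u y \<tau>) (c * u y 0) < e"
        using \<delta>(2)[of "(y, 0)" "(y, \<tau>)"] \<tau> that by (simp add: dist_Pair_Pair)
      then show ?thesis
        using init[OF that] by (simp add: u_def \<rho>_init[OF that] dist_real_def)
    qed
    \<comment> \<open>The gradient of the density is continuous for positive times, so the drift is
      bounded on the compact cylinder that starts at \<open>\<tau> > 0\<close>.\<close>
    have "continuous_on (?S \<times> {\<tau>..t}) (\<lambda>(x, t). b x t)"
    proof -
      have "?S \<times> {\<tau>..t} \<subseteq> ?S \<times> {0..}" "?S \<times> {\<tau>..t} \<subseteq> ?S \<times> {0<..}"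
        using \<tau> by auto
      then have "continuous_on (?S \<times> {\<tau>..t}) (\<lambda>z. \<rho> (fst z) (snd z))"
        "continuous_on (?S \<times> {\<tau>..t}) (\<lambda>z. g (fst z) (snd z))"
        using continuous_on_subset[OF \<rho>_cont] continuous_on_subset[OF g_cont]
        by (simp_all add: case_prod_unfold)
      moreover have "\<rho> (fst z) (snd z) \<noteq> 0" if "z \<in> ?S \<times> {\<tau>..t}" for z
        using \<rho>_pos[of "fst z" "snd z"] that \<tau> by auto
      ultimately show ?thesis
        using fst_cont[OF d_cont] unfolding b_def case_prod_unfold
        by (intro continuous_intros) auto
    qed
    moreover have "compact (?S \<times> {\<tau>..t})"
      using \<Omega>(3) by (intro compact_Times) (auto simp: compact_closure)
    ultimately have "bounded ((\<lambda>(x, t). b x t) ` (?S \<times> {\<tau>..t}))"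
      by (intro compact_imp_bounded compact_continuous_image)
    then obtain B where B: "\<And>y s. y \<in> ?S \<Longrightarrow> \<tau> \<le> s \<Longrightarrow> s \<le> t \<Longrightarrow> norm (b y s) \<le> B"
      unfolding bounded_iff by fastforce
    \<comment> \<open>The maximum principle from time \<open>\<tau>\<close> on, with diffusion
      coefficient \<open>d\<close> and with \<open>M + e\<close> as the bound at the starting
      time.\<close>
    have "c * u x t \<le> M + e"
    proof (rule neumann_maximum_principle[where u = "\<lambda>y s. c * u y s" and \<tau> = \<tau> and T = t
          and G = "\<lambda>y s. c *\<^sub>R G y s" and D = "\<lambda>y s h. c *\<^sub>R D y s h" and a = "\<lambda>y s. d y"
          and A = A and b = b and B = B, OF \<Omega> normal])
      show "continuous_on (?S \<times> {\<tau>..t}) (\<lambda>(x, t). c * u x t)"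
        using \<tau> by (intro u_cont') simp
      show "((\<lambda>y. c * u y s) has_derivative (\<lambda>h. c *\<^sub>R G y s \<bullet> h)) (at y within ?S)"
        if "y \<in> ?S" "\<tau> < s" for y s
        using has_derivative_mult_right[OF G[of y s], of c] that \<tau> by simp
      show "((\<lambda>y. c *\<^sub>R G y s) has_derivative (\<lambda>h. c *\<^sub>R D y s h)) (at y)"
        if "y \<in> \<Omega>" "\<tau> < s" for y s
        using has_derivative_scaleR_right[OF D[of y s], of c] that \<tau> by simp
      show "((\<lambda>s. c * u y s) has_real_derivative
          d y * trace (matrix (\<lambda>h. c *\<^sub>R D y s h)) + b y s \<bullet> c *\<^sub>R G y s) (at s)"
        if "y \<in> \<Omega>" "\<tau> < s" for y s
      proof -
        have "trace (matrix (\<lambda>h. c *\<^sub>R D y s h)) = c * trace (matrix (D y s))"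
          by (simp add: trace_def matrix_def sum_distrib_left)
        then show ?thesis
          using DERIV_cmult[OF u_t[of y s], of c] that \<tau> by (simp add: algebra_simps)
      qed
      show "0 \<le> d y \<and> d y \<le> A" if "y \<in> \<Omega>" for y
        by (rule d_bounds[OF that])
      show "norm (b y s) \<le> B" if "y \<in> \<Omega>" "\<tau> < s" "s \<le> t" for y s
        using B that sub by auto
      show "c *\<^sub>R G y s \<bullet> \<nu> y = 0" if "y \<in> frontier \<Omega>" "\<tau> < s" for y s
        using neumann that \<tau> by simp
    qed (use init_\<tau> x \<tau> in auto)
    then show "c * (d x * ln (\<rho> x t) + \<phi> x) \<le> M + e"
      by (simp add: u_def)
  qed
qed

section \<open>From the potential to two-sided bounds for the density\<close>

theorem theorem1p1:
  fixes \<Omega> :: "(real^'n) set"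
    and \<nu> :: "real^'n \<Rightarrow> real^'n"
    and d \<phi> \<rho>0 :: "real^'n \<Rightarrow> real"
  assumes domain: "open \<Omega>" "\<Omega> \<noteq> {}" "bounded \<Omega>" "convex \<Omega>" "smooth_boundary \<Omega>"
    and normal: "\<forall>x\<in>frontier \<Omega>. outer_unit_normal \<Omega> x (\<nu> x)"
    and d_C2: "C_on 2 (closure \<Omega>) d"
    and d_bounds: "\<exists>d_min>0. \<exists>d_max>0. \<forall>x\<in>\<Omega>. d_min \<le> d x \<and> d x \<le> d_max"
    and phi_C2: "C_on 2 (closure \<Omega>) \<phi>"
    and phi_convex: "\<exists>l>0. \<forall>x\<in>\<Omega>. \<forall>\<xi>. l * (\<xi> \<bullet> \<xi>) \<le> \<xi> \<bullet> (hess \<Omega> \<phi> x *v \<xi>)"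
    and rho0_C2: "C_on 2 (closure \<Omega>) \<rho>0"
    and rho0_pos: "\<forall>x\<in>closure \<Omega>. \<rho>0 x > 0"
    and rho0_density: "(\<rho>0 has_integral 1) \<Omega>"
  shows "\<exists>c1>0. \<exists>c2>0. \<forall>\<rho>. classical_solution \<Omega> \<nu> d \<phi> \<rho>0 \<rho> \<longrightarrow>
           (\<forall>x\<in>\<Omega>. \<forall>t\<ge>0. c1 \<le> \<rho> x t \<and> \<rho> x t \<le> c2)"
proof -
  obtain d_min d_max where dm: "d_min > 0" "\<And>x. x \<in> \<Omega> \<Longrightarrow> d_min \<le> d x \<and> d x \<le> d_max"
    using d_bounds by blast
  have cont: "continuous_on (closure \<Omega>) d" "continuous_on (closure \<Omega>) \<phi>"
    "continuous_on (closure \<Omega>) \<rho>0"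
    using d_C2 phi_C2 rho0_C2 by (auto simp: numeral_2_eq_2 differentiable_imp_continuous_on)
  have comp: "compact (closure \<Omega>)"
    using domain(3) by (simp add: compact_closure)
  have "continuous_on (closure \<Omega>) (\<lambda>x. d x * ln (\<rho>0 x) + \<phi> x)"
    using cont rho0_pos by (intro continuous_intros) force+
  then have "bounded ((\<lambda>x. d x * ln (\<rho>0 x) + \<phi> x) ` closure \<Omega>)"
    using comp by (intro compact_imp_bounded compact_continuous_image)
  then obtain M where M: "\<And>x. x \<in> closure \<Omega> \<Longrightarrow> \<bar>d x * ln (\<rho>0 x) + \<phi> x\<bar> \<le> M"
    by (auto simp: bounded_iff)
  have "bounded (\<phi> ` closure \<Omega>)"
    using comp cont(2) by (intro compact_imp_bounded compact_continuous_image)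
  then obtain P where P: "\<And>x. x \<in> closure \<Omega> \<Longrightarrow> \<bar>\<phi> x\<bar> \<le> P"
    by (auto simp: bounded_iff)
  \<comment> \<open>\<open>d\<close> times the logarithm of the density is the potential minus
    \<open>\<phi>\<close>, so it is bounded by \<open>M + P\<close>; dividing by
    \<open>d_min\<close> bounds the logarithm itself. All these constants are fixed before a
    solution is chosen.\<close>
  define L where "L = (M + P) / d_min"
  have "exp (- L) \<le> \<rho> x t \<and> \<rho> x t \<le> exp L"
    if sol: "classical_solution \<Omega> \<nu> d \<phi> \<rho>0 \<rho>" and x: "x \<in> \<Omega>" and t: "t \<ge> 0" for \<rho> x t
  proof -
    have x': "x \<in> closure \<Omega>"
      using x closure_subset by blast
    have pos: "\<rho> x t > 0"
    proof (cases "t = 0")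
      case True
      then show ?thesis
        using sol x x' rho0_pos by (simp add: classical_solution_def)
    next
      case False
      then show ?thesis
        using sol x' t by (simp add: classical_solution_def)
    qed
    have d_nonneg: "0 \<le> d y \<and> d y \<le> d_max" if "y \<in> \<Omega>" for y
      using dm(2)[OF that] dm(1) by linarith
    \<comment> \<open>Both signs of \<open>c\<close> together bound the absolute value of the
      potential by its initial bound \<open>M\<close>.\<close>
    have "c * (d x * ln (\<rho> x t) + \<phi> x) \<le> M" if "\<bar>c\<bar> = 1" for c
    proof (rule potential_maximum_principle[OF domain(1-4) _ d_C2 d_nonneg phi_C2 cont(3) _ sol])
      show "c * (d y * ln (\<rho>0 y) + \<phi> y) \<le> M" if "y \<in> closure \<Omega>" for y
        using M[OF that] \<open>\<bar>c\<bar> = 1\<close> by (auto simp: abs_if split: if_splits)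
    qed (use normal rho0_pos x' t in auto)
    from this[of 1] this[of "- 1"]
    have "\<bar>d x * ln (\<rho> x t)\<bar> \<le> M + P"
      using P[OF x'] by (simp add: abs_le_iff)
    moreover have "d_min * \<bar>ln (\<rho> x t)\<bar> \<le> \<bar>d x * ln (\<rho> x t)\<bar>"
      using dm(1) dm(2)[OF x] by (auto simp: abs_mult intro!: mult_right_mono)
    ultimately have "\<bar>ln (\<rho> x t)\<bar> \<le> L"
      using dm(1) by (simp add: L_def field_simps)
    then show ?thesis
      using pos by (metis abs_le_iff exp_le_cancel_iff exp_ln minus_le_iff)
  qed
  then show ?thesis
    by (intro exI[of _ "exp (- L)"] conjI exI[of _ "exp L"]) auto
qed

end
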